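(* There is an absolute constant $C_1$ with the following property. Let $\omega_\theta:\Omega\to\mathbb{R}$ satisfy $$\|r^2\omega_\theta\|_{L^1(\Omega)}<\infty,\quad\|\omega_\theta\|_{L^1(\Omega)}<\infty,\quad\Big\|\frac{\omega_\theta}{r}\Big\|_{L^\infty(\Omega)}<\infty,$$ and let $$u_r(\bar r,\bar z)=\int_{-\infty}^\infty\int_0^\infty\frac{z-\bar z}{\pi\,\bar r^{3/2}\sqrt r}\,F'\!\left(\frac{(r-\bar r)^2+(z-\bar z)^2}{\bar r r}\right)\omega_\theta(r,z)\,dr\,dz .$$ Then $$\|u_r\|_{L^\infty(\Omega)}\le C_1\,\|r^2\omega_\theta\|_{L^1(\Omega)}^{1/4}\,\|\omega_\theta\|_{L^1(\Omega)}^{1/4}\,\Big\|\frac{\omega_\theta}{r}\Big\|_{L^\infty(\Omega)}^{1/2}.$$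
   Context: $\Omega=\{(r,z): r\ge0,\ z\in\mathbb{R}\}$ is the $rz$-half-plane with the measure $dr\,dz$. The function $F:(0,\infty)\to\mathbb{R}$ is $F(s)=\int_0^\pi\frac{\cos\varphi\,d\varphi}{[2(1-\cos\varphi)+s]^{1/2}}$. (The formula for $u_r$ is the axi-symmetric Biot–Savart law for the radial component of the swirl-free axi-symmetric field with vorticity $\omega_\theta e_\theta$.) *)

theory Defs
  imports "HOL-Analysis.Analysis" "HOL-Probability.Essential_Supremum"
begin

definition half_plane :: "(real \<times> real) set" where
  "half_plane = {(r, z). r \<ge> 0}"

(* Lebesgue measure dr dz (complete, and without the cylindrical weight r) on the half-plane.
   Functions on the half-plane are represented by total functions on the plane; their values
   at r < 0 are never inspected. *)
abbreviation half_plane_measure :: "(real \<times> real) measure" where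
  "half_plane_measure \<equiv> lebesgue_on half_plane"

definition L1_norm :: "'a measure \<Rightarrow> ('a \<Rightarrow> real) \<Rightarrow> ennreal" where
  "L1_norm M f = (\<integral>\<^sup>+ x. ennreal \<bar>f x\<bar> \<partial>M)"

(* esssup is infinite on non-measurable functions. *)
definition Linf_norm :: "'a measure \<Rightarrow> ('a \<Rightarrow> real) \<Rightarrow> ennreal" where
  "Linf_norm M f = esssup M (\<lambda>x. ennreal \<bar>f x\<bar>)"

(* Only meaningful for s > 0. *)
definition F :: "real \<Rightarrow> real" where
  "F s = integral {0..pi} (\<lambda>\<phi>. cos \<phi> / sqrt (2 * (1 - cos \<phi>) + s))"

(* The integrand of u_r: the first argument is the point (rbar, zbar) at which the velocity is
   evaluated, the last one the integration variable (r, z). Division by zero (rbar = 0 or r = 0) and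
   F' at 0 ((r, z) = (rbar, zbar)) only occur on null sets. *)
definition biot_savart_integrand ::
    "(real \<times> real \<Rightarrow> real) \<Rightarrow> real \<times> real \<Rightarrow> real \<times> real \<Rightarrow> real" where
  "biot_savart_integrand \<omega> = (\<lambda>(rb, zb) (r, z).
     (z - zb) / (pi * rb powr (3/2) * sqrt r)
       * deriv F (((r - rb)\<^sup>2 + (z - zb)\<^sup>2) / (rb * r)) * \<omega> (r, z))"

definition radial_velocity :: "(real \<times> real \<Rightarrow> real) \<Rightarrow> real \<times> real \<Rightarrow> real" where
  "radial_velocity \<omega> p = (\<integral> q. biot_savart_integrand \<omega> p q \<partial>half_plane_measure)"

end

theory Submission
  imports Defs
begin

text \<open>
  The velocity bound is an interpolation between the mass of the vorticity and its maximum, done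
  with one pointwise bound for the Biot-Savart kernel. Write \<open>d\<close> for the distance from \<open>(r, z)\<close> to
  the point \<open>(rb, zb)\<close> and \<open>e\<close> for the distance to its mirror image \<open>(-rb, zb)\<close>, so that
  \<open>e\<^sup>2 = d\<^sup>2 + 4 rb r\<close>. Jordan's inequality \<open>2 (1 - cos \<phi>) \<ge> 4 \<phi>\<^sup>2 / \<pi>\<^sup>2\<close> turns the integral for
  \<open>F'\<close> into an elementary one and gives \<open>\<bar>F'(s)\<bar> \<le> \<pi> / (2 s sqrt (4 + s))\<close> (\<open>abs_deriv_F_le\<close>). With
  \<open>s = d\<^sup>2 / (rb r)\<close> the factor \<open>sqrt (4 + s)\<close> is \<open>e / sqrt (rb r)\<close>, the remaining powers of \<open>rb\<close> cancel, and
  the kernel is bounded by \<open>r / (2 d e)\<close> (\<open>abs_bs_kernel_le\<close>). This single expression has both the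
  two-dimensional singularity close to the point and the three-dimensional decay away from it.

  Let \<open>D\<close> be the essential supremum of \<open>\<bar>\<omega>\<bar> / r\<close>, let \<open>M\<close> be the integral of \<open>r \<bar>\<omega>\<bar>\<close> and fix \<open>t > 0\<close>. Where
  the kernel is at most \<open>t r\<close>, the contribution is at most \<open>t M\<close>. Elsewhere
  \<open>d e < \<rho>\<^sup>2 = 1 / (2 t)\<close>; since \<open>e \<ge> d\<close> and \<open>e \<ge> r + rb\<close>, such points satisfy both \<open>d < \<rho>\<close> and
  \<open>d < \<rho>\<^sup>2 / rb\<close>, and there the kernel times \<open>\<bar>\<omega>\<bar>\<close> is at most
  \<open>D r\<^sup>2 / (2 d e) \<le> (D / 2) (1 + rb / d)\<close>. The function \<open>1\<close> is integrated over the box of half-width \<open>\<rho>\<close>,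
  the function \<open>rb / d\<close> over the box of half-width \<open>\<rho>\<^sup>2 / rb\<close>; in the plane the latter integral is
  of order \<open>rb \<cdot> \<rho>\<^sup>2 / rb\<close>, so \<open>rb\<close> cancels and both are of order \<open>\<rho>\<^sup>2\<close> (\<open>bs_kernel_split\<close>,
  \<open>nn_integral_bs_kernel_le\<close>). Hence \<open>\<bar>u\<bar> \<le> t M + 5 D / t\<close>, uniformly in the point, and the best \<open>t\<close>
  gives \<open>\<bar>u\<bar> \<le> 2 sqrt (5 M D)\<close>. Finally \<open>M\<close> is at most the geometric mean of the integrals of
  \<open>r\<^sup>2 \<bar>\<omega>\<bar>\<close> and \<open>\<bar>\<omega>\<bar>\<close> (\<open>radial_moment_le\<close>).

  Because the essential supremum is infinite for non-measurable functions, the velocity must also be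
  shown to be measurable; this is Fubini's theorem, after replacing the kernel and the vorticity by
  Borel functions (\<open>borel_measurable_radial_velocity\<close>).
\<close>

section \<open>The derivative of the profile function\<close>

text \<open>
  On \<open>[0, \<pi>/2]\<close> the sine is concave, hence lies above its chord.
\<close>

lemma jordan_sine_inequality:
  fixes t :: real
  assumes "0 \<le> t" "t \<le> pi / 2"
  shows "2 * t / pi \<le> sin t"
proof -
  have conv: "convex_on {0..pi/2} (\<lambda>x::real. - sin x)"
  proof (rule f''_ge0_imp_convex)
    show "convex {0..pi/2}" by simp
    show "((\<lambda>x. - sin x) has_real_derivative - cos x) (at x)" for x :: real
      by (auto intro!: derivative_eq_intros)
    show "((\<lambda>x. - cos x) has_real_derivative sin x) (at x)" for x :: real
      by (auto intro!: derivative_eq_intros)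
    show "x \<in> {0..pi/2} \<Longrightarrow> 0 \<le> sin x" for x :: real
      using pi_gt_zero by (intro sin_ge_zero) (auto simp: field_simps)
  qed
  have "- sin ((1 - 2 * t / pi) *\<^sub>R 0 + (2 * t / pi) *\<^sub>R (pi / 2))
      \<le> (1 - 2 * t / pi) * (- sin 0) + (2 * t / pi) * (- sin (pi / 2))"
    by (rule convex_onD[OF conv]) (use assms in \<open>auto simp: field_simps\<close>)
  then show ?thesis by simp
qed

lemma one_minus_cos_ge:
  fixes \<phi> :: real
  assumes "0 \<le> \<phi>" "\<phi> \<le> pi"
  shows "4 * \<phi>\<^sup>2 / pi\<^sup>2 \<le> 2 * (1 - cos \<phi>)"
proof -
  have "2 * (\<phi> / 2) / pi \<le> sin (\<phi> / 2)"
    by (rule jordan_sine_inequality) (use assms in auto)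
  then have "(\<phi> / pi)\<^sup>2 \<le> (sin (\<phi> / 2))\<^sup>2"
    by (intro power_mono) (use assms in auto)
  moreover have "cos \<phi> = 1 - 2 * (sin (\<phi> / 2))\<^sup>2"
    using cos_double_sin[of "\<phi> / 2"] by simp
  ultimately show ?thesis by (simp add: power_divide)
qed

text \<open>
  Differentiation under the integral sign: for \<open>s > 0\<close> the denominator has no zero, so the
  integrand is smooth in \<open>s\<close> with a jointly continuous derivative.
\<close>

lemma has_field_derivative_F:
  assumes "s > 0"
  shows "(F has_field_derivative
           integral {0..pi} (\<lambda>\<phi>. - cos \<phi> /
             (2 * ((2 * (1 - cos \<phi>) + s) * sqrt (2 * (1 - cos \<phi>) + s))))) (at s)"
proof -
  let ?X = "\<lambda>x \<phi>. 2 * (1 - cos \<phi>) + x :: real"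
  have pos: "0 < ?X x \<phi>" if "x > 0" for x \<phi> :: real
    using that cos_le_one[of \<phi>] by (intro add_nonneg_pos) auto
  have "((\<lambda>x. integral (cbox 0 pi) (\<lambda>\<phi>. cos \<phi> / sqrt (?X x \<phi>))) has_field_derivative
      integral (cbox 0 pi) (\<lambda>\<phi>. - cos \<phi> / (2 * (?X s \<phi> * sqrt (?X s \<phi>))))) (at s within {0<..})"
  proof (rule leibniz_rule_field_derivative)
    fix x t :: real assume "x \<in> {0<..}"
    then have "0 < ?X x t" using pos by simp
    then show "((\<lambda>x. cos t / sqrt (?X x t)) has_field_derivative
        - cos t / (2 * (?X x t * sqrt (?X x t)))) (at x within {0<..})"
      by (auto intro!: derivative_eq_intros simp: field_simps)
  next
    fix x :: real assume "x \<in> {0<..}"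
    then have "0 < ?X x t" for t using pos by simp
    then have "?X x t \<noteq> 0" for t by (metis less_irrefl)
    then show "(\<lambda>\<phi>. cos \<phi> / sqrt (?X x \<phi>)) integrable_on cbox 0 pi"
      by (intro integrable_continuous continuous_intros) auto
  next
    have "0 < ?X x t" if "x \<in> {0<..}" for x t using pos that by simp
    then have nz: "?X x t \<noteq> 0" if "x \<in> {0<..}" for x t using that by (metis less_irrefl)
    show "continuous_on ({0<..} \<times> cbox 0 pi) (\<lambda>(x, t). - cos t / (2 * (?X x t * sqrt (?X x t))))"
      unfolding split_beta using nz by (intro continuous_intros) auto
  qed (use assms in auto)
  then show ?thesis
    using assms by (simp add: F_def[abs_def] at_within_open[of s "{0<..}"])
qed

lemmas deriv_F = has_field_derivative_F[THEN DERIV_imp_deriv]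

lemma continuous_on_deriv_F: "continuous_on {0<..} (deriv F)"
proof -
  let ?X = "\<lambda>x \<phi>. 2 * (1 - cos \<phi>) + x :: real"
  have "0 < ?X x \<phi>" if "x > 0" for x \<phi> :: real
    using that cos_le_one[of \<phi>] by (intro add_nonneg_pos) auto
  then have nz: "?X x \<phi> \<noteq> 0" if "x \<in> {0<..}" for x \<phi>
    using that by (metis greaterThan_iff less_irrefl)
  have "continuous_on {0<..} (\<lambda>x. integral (cbox 0 pi) (\<lambda>\<phi>. - cos \<phi> / (2 * (?X x \<phi> * sqrt (?X x \<phi>)))))"
    by (rule integral_continuous_on_param, unfold split_beta, intro continuous_intros)
       (use nz in auto)
  then show ?thesis
    by (subst continuous_on_cong[OF refl]) (auto simp: deriv_F)
qed

text \<open>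
  After \<open>\<bar>cos \<phi>\<bar> \<le> 1\<close> and \<open>2 (1 - cos \<phi>) \<ge> 4 \<phi>\<^sup>2 / \<pi>\<^sup>2\<close> the integrand of \<open>F'\<close> is dominated by
  \<open>1 / (2 Y sqrt Y)\<close> with \<open>Y = 4 \<phi>\<^sup>2 / \<pi>\<^sup>2 + s\<close>, which has the primitive \<open>\<phi> / (2 s sqrt Y)\<close>. Its value
  at \<open>\<pi>\<close> is the bound; the constant of Jordan's inequality is what makes \<open>Y = 4 + s\<close> there, which is
  the combination that turns into the mirror distance below.
\<close>

lemma abs_deriv_F_le:
  assumes s: "s > 0"
  shows "\<bar>deriv F s\<bar> \<le> pi / (2 * s * sqrt (4 + s))"
proof -
  let ?X = "\<lambda>\<phi>. 2 * (1 - cos \<phi>) + s :: real"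
  let ?Y = "\<lambda>\<phi>. 4 * \<phi>\<^sup>2 / pi\<^sup>2 + s :: real"
  let ?G = "\<lambda>\<phi>. \<phi> / (2 * s * sqrt (?Y \<phi>))"
  have Y: "0 < ?Y \<phi>" for \<phi> using s by (intro add_nonneg_pos) auto
  have YX: "?Y \<phi> \<le> ?X \<phi>" if "\<phi> \<in> {0..pi}" for \<phi>
    using one_minus_cos_ge[of \<phi>] that by auto
  have "((\<lambda>\<phi>. 1 / (2 * (?Y \<phi> * sqrt (?Y \<phi>)))) has_integral (?G pi - ?G 0)) {0..pi}"
  proof (rule fundamental_theorem_of_calculus)
    fix x :: real
    have sq: "sqrt (?Y x) * sqrt (?Y x) = ?Y x" and sp: "0 < sqrt (?Y x)" using Y[of x] by auto
    have dY: "(?Y has_real_derivative 8 * x / pi\<^sup>2) (at x)"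
      by (auto intro!: derivative_eq_intros simp: field_simps)
    have dS: "((\<lambda>\<phi>. sqrt (?Y \<phi>)) has_real_derivative (8 * x / pi\<^sup>2) / (2 * sqrt (?Y x))) (at x)"
      using DERIV_chain'[OF dY DERIV_real_sqrt[OF Y[of x]]] by (simp add: field_simps)
    let ?N = "1 * (2 * s * sqrt (?Y x)) - x * (2 * s * ((8 * x / pi\<^sup>2) / (2 * sqrt (?Y x))))"
    let ?D = "(2 * s * sqrt (?Y x)) * (2 * s * sqrt (?Y x))"
    have dG: "(?G has_real_derivative ?N / ?D) (at x)"
      by (intro DERIV_divide DERIV_ident DERIV_cmult dS) (use s sp in simp)
    have "?N = 2 * s * (sqrt (?Y x) * sqrt (?Y x) - 4 * x\<^sup>2 / pi\<^sup>2) / sqrt (?Y x)"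
      using sp by (simp add: field_simps power2_eq_square del: real_sqrt_mult_self)
    then have N: "?N = 2 * s * s / sqrt (?Y x)" unfolding sq by simp
    have D: "?D = 4 * s * s * ?Y x"
      using sq by (simp add: mult_ac)
    have "?N / ?D = 1 / (2 * (?Y x * sqrt (?Y x)))"
      unfolding N D using s sp Y[of x] by (simp add: divide_simps)
    then have "(?G has_real_derivative 1 / (2 * (?Y x * sqrt (?Y x)))) (at x)"
      using dG by metis
    then show "(?G has_vector_derivative 1 / (2 * (?Y x * sqrt (?Y x)))) (at x within {0..pi})"
      unfolding has_real_derivative_iff_has_vector_derivative
      by (rule has_vector_derivative_at_within)
  qed simp
  then have Y_int: "((\<lambda>\<phi>. 1 / (2 * (?Y \<phi> * sqrt (?Y \<phi>)))) has_integral pi / (2 * s * sqrt (4 + s))) {0..pi}"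
    by simp
  have nz: "?X \<phi> \<noteq> 0" for \<phi> 
    using s cos_le_one[of \<phi>] by (metis add_nonneg_pos diff_ge_0_iff_ge less_irrefl mult_nonneg_nonneg zero_le_numeral)
  have "norm (integral {0..pi} (\<lambda>\<phi>. - cos \<phi> / (2 * (?X \<phi> * sqrt (?X \<phi>)))))
      \<le> integral {0..pi} (\<lambda>\<phi>. 1 / (2 * (?Y \<phi> * sqrt (?Y \<phi>))))"
  proof (rule integral_norm_bound_integral)
    show "(\<lambda>\<phi>. - cos \<phi> / (2 * (?X \<phi> * sqrt (?X \<phi>)))) integrable_on {0..pi}"
      using nz by (intro integrable_continuous_interval continuous_intros) auto
    show "(\<lambda>\<phi>. 1 / (2 * (?Y \<phi> * sqrt (?Y \<phi>)))) integrable_on {0..pi}"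
      using Y_int by blast
    fix \<phi> assume "\<phi> \<in> {0..pi}"
    then have "?Y \<phi> \<le> ?X \<phi>" by (rule YX)
    then have "?Y \<phi> * sqrt (?Y \<phi>) \<le> ?X \<phi> * sqrt (?X \<phi>)" "0 < ?Y \<phi> * sqrt (?Y \<phi>)"
      using Y[of \<phi>] by (auto intro!: mult_mono)
    then have "\<bar>cos \<phi>\<bar> / (2 * (?X \<phi> * sqrt (?X \<phi>))) \<le> 1 / (2 * (?Y \<phi> * sqrt (?Y \<phi>)))"
      by (intro frac_le) auto
    moreover have "0 < ?X \<phi>" using \<open>?Y \<phi> \<le> ?X \<phi>\<close> Y[of \<phi>] by linarith
    ultimately show "norm (- cos \<phi> / (2 * (?X \<phi> * sqrt (?X \<phi>)))) \<le> 1 / (2 * (?Y \<phi> * sqrt (?Y \<phi>)))"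
      by (simp add: abs_mult)
  qed
  then show ?thesis using integral_unique[OF Y_int] by (simp add: deriv_F[OF s])
qed

section \<open>The Biot-Savart kernel\<close>

definition bs_kernel :: "real \<times> real \<Rightarrow> real \<times> real \<Rightarrow> real" where
  "bs_kernel p q = (snd q - snd p) / (pi * fst p powr (3/2) * sqrt (fst q))
     * deriv F (((fst q - fst p)\<^sup>2 + (snd q - snd p)\<^sup>2) / (fst p * fst q))"

lemma biot_savart_integrand_eq: "biot_savart_integrand \<omega> p q = bs_kernel p q * \<omega> q"
  by (simp add: biot_savart_integrand_def bs_kernel_def split_beta)

text \<open>
  The two roots are the distances of \<open>(r, z)\<close> from \<open>(rb, zb)\<close> and from the mirror image
  \<open>(-rb, zb)\<close>. The bound follows from \<open>abs_deriv_F_le\<close> at \<open>s = d\<^sup>2 / (rb r)\<close>, because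
  \<open>4 + s = e\<^sup>2 / (rb r)\<close>, and from \<open>\<bar>z - zb\<bar> \<le> d\<close>. If \<open>r = 0\<close> or
  \<open>(r, z) = (rb, zb)\<close>, both sides are \<open>0\<close> by the convention \<open>x / 0 = 0\<close>, so no point is excluded.
\<close>

lemma abs_bs_kernel_le:
  assumes rb: "rb > 0" and r: "r \<ge> 0"
  shows "\<bar>bs_kernel (rb, zb) (r, z)\<bar>
    \<le> r / (2 * sqrt ((r - rb)\<^sup>2 + (z - zb)\<^sup>2) * sqrt ((r + rb)\<^sup>2 + (z - zb)\<^sup>2))"
proof (cases "r = 0 \<or> z = zb")
  case True
  then show ?thesis using r by (auto simp: bs_kernel_def)
next
  case False
  then have r0: "r > 0" and zz: "z \<noteq> zb" using r by auto
  define d where "d = sqrt ((r - rb)\<^sup>2 + (z - zb)\<^sup>2)"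
  define e where "e = sqrt ((r + rb)\<^sup>2 + (z - zb)\<^sup>2)"
  define a b where "a = sqrt rb" and "b = sqrt r"
  have ab: "a > 0" "b > 0" "rb = a * a" "r = b * b" using rb r0 by (auto simp: a_def b_def)
  have d0: "d > 0" "e > 0" unfolding d_def e_def using zz by (auto intro!: add_nonneg_pos)
  have zd: "\<bar>z - zb\<bar> \<le> d" unfolding d_def by (rule real_le_rsqrt) auto
  define s where "s = d\<^sup>2 / (rb * r)"
  have d2: "d\<^sup>2 = (r - rb)\<^sup>2 + (z - zb)\<^sup>2" unfolding d_def by simp
  have s0: "s > 0" using d0 rb r0 by (simp add: s_def)
  have e2: "e\<^sup>2 = (r + rb)\<^sup>2 + (z - zb)\<^sup>2" unfolding e_def by simp
  have "4 + s = e\<^sup>2 / (rb * r)"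
    using rb r0 unfolding s_def d2 e2 by (simp add: field_simps power2_eq_square)
  then have s4: "sqrt (4 + s) = e / (a * b)"
    using d0 by (simp add: real_sqrt_divide real_sqrt_mult a_def b_def)
  have p32: "rb powr (3/2) = rb * a"
    using rb powr_add[of rb 1 "1/2"] by (simp add: powr_half_sqrt a_def)
  have "\<bar>bs_kernel (rb, zb) (r, z)\<bar> = \<bar>z - zb\<bar> / (pi * (rb * a) * b) * \<bar>deriv F s\<bar>"
    using rb r0 ab(1,2) by (simp add: bs_kernel_def p32 s_def d2 abs_mult b_def)
  also have "\<dots> \<le> d / (pi * (rb * a) * b) * (pi / (2 * s * sqrt (4 + s)))"
    by (intro mult_mono divide_right_mono zd abs_deriv_F_le s0) (use rb ab d0 in auto)
  also have "\<dots> = r / (2 * d * e)"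
    unfolding s4 unfolding s_def using ab d0
    by (simp add: field_simps power2_eq_square)
  finally show ?thesis by (simp add: d_def e_def)
qed

section \<open>Elementary inequalities\<close>

text \<open>
  Optimisation over \<open>t\<close>. The optimal \<open>t = sqrt b / sqrt a\<close> exists only if both numbers are positive; to
  treat all cases at once, both roots are shifted by a small \<open>e > 0\<close>, which costs an error of order \<open>e\<close>.
\<close>

lemma le_two_sqrt_mult:
  fixes x a b :: real
  assumes a: "a \<ge> 0" and b: "b \<ge> 0"
    and bound: "\<And>t. t > 0 \<Longrightarrow> x \<le> t * a + b / t"
  shows "x \<le> 2 * sqrt (a * b)"
proof -
  have near: "x \<le> 2 * sqrt (a * b) + e * (sqrt a + sqrt b)" if e: "e > 0" for e
  proof -
    define \<alpha> \<beta> where "\<alpha> = sqrt a" and "\<beta> = sqrt b"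
    have ab: "a = \<alpha> * \<alpha>" "b = \<beta> * \<beta>" "\<alpha> \<ge> 0" "\<beta> \<ge> 0"
      using a b by (auto simp: \<alpha>_def \<beta>_def)
    have "x \<le> (\<beta> + e) / (\<alpha> + e) * a + b / ((\<beta> + e) / (\<alpha> + e))"
      by (rule bound) (use ab e in auto)
    also have "(\<beta> + e) / (\<alpha> + e) * a = (\<beta> + e) * \<alpha> * (\<alpha> / (\<alpha> + e))"
      by (simp add: ab(1))
    also have "\<dots> \<le> (\<beta> + e) * \<alpha> * 1"
      by (rule mult_left_mono) (use ab(3,4) e in auto)
    also have "b / ((\<beta> + e) / (\<alpha> + e)) = (\<alpha> + e) * \<beta> * (\<beta> / (\<beta> + e))"
      by (simp add: ab(2))
    also have "\<dots> \<le> (\<alpha> + e) * \<beta> * 1"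
      by (rule mult_left_mono) (use ab(3,4) e in auto)
    finally show ?thesis
      by (simp add: \<alpha>_def \<beta>_def real_sqrt_mult algebra_simps)
  qed
  show ?thesis
  proof (rule field_le_epsilon)
    fix \<epsilon> :: real assume \<epsilon>: "\<epsilon> > 0"
    let ?c = "sqrt a + sqrt b + 1"
    have c: "?c > 0" using a b by (simp add: add_nonneg_pos)
    have "x \<le> 2 * sqrt (a * b) + \<epsilon> / ?c * (sqrt a + sqrt b)"
      using near[of "\<epsilon> / ?c"] \<epsilon> c by simp
    also have "\<epsilon> / ?c * (sqrt a + sqrt b) \<le> \<epsilon> / ?c * ?c"
      using \<epsilon> c by (intro mult_left_mono) auto
    also have "\<dots> = \<epsilon>" using c by simp
    finally show "x \<le> 2 * sqrt (a * b) + \<epsilon>" by simp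
  qed
qed

lemma ennreal_linear_combination:
  assumes "0 \<le> a" "0 \<le> b" "0 \<le> x" "0 \<le> y"
  shows "ennreal (a * x + b * y) = ennreal a * ennreal x + ennreal b * ennreal y"
  using assms by (simp add: ennreal_plus ennreal_mult)

text \<open>
  A function of one variable whose tensor square dominates \<open>1 / d\<close> on the disc of radius \<open>R\<close>. It
  replaces polar coordinates: its integral over the plane is a product of two one-dimensional ones.
  Its value at \<open>0\<close> is \<open>0\<close>, so the domination fails on the two axes, a null set.
\<close>

definition inv_sqrt_near :: "real \<Rightarrow> real \<Rightarrow> real" where
  "inv_sqrt_near R x = indicator {-R..R} x * \<bar>x\<bar> powr (-1/2)"

lemma inv_sqrt_near_nonneg: "0 \<le> inv_sqrt_near R x"
  by (simp add: inv_sqrt_near_def)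

text \<open>
  Both indicators are \<open>1\<close> on the disc, so the product is \<open>1 / sqrt (\<bar>x\<bar> \<bar>y\<bar>)\<close>, and
  \<open>\<bar>x\<bar> \<bar>y\<bar> \<le> x\<^sup>2 + y\<^sup>2\<close>.
\<close>

lemma inverse_norm_le_inv_sqrt_near:
  assumes "x \<noteq> 0" "y \<noteq> 0" "sqrt (x\<^sup>2 + y\<^sup>2) \<le> R"
  shows "1 / sqrt (x\<^sup>2 + y\<^sup>2) \<le> inv_sqrt_near R x * inv_sqrt_near R y"
proof -
  have "\<bar>x\<bar> \<le> sqrt (x\<^sup>2 + y\<^sup>2)" "\<bar>y\<bar> \<le> sqrt (x\<^sup>2 + y\<^sup>2)"
    by (rule real_sqrt_ge_abs1 real_sqrt_ge_abs2)+
  then have "\<bar>x\<bar> \<le> R" "\<bar>y\<bar> \<le> R"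
    using assms(3) by linarith+
  then have ind: "inv_sqrt_near R x * inv_sqrt_near R y = 1 / sqrt (\<bar>x\<bar> * \<bar>y\<bar>)"
    using assms(1,2)
    by (auto simp: inv_sqrt_near_def indicator_def powr_minus powr_half_sqrt real_sqrt_mult field_simps
        minus_divide_left[symmetric] powr_minus_divide)
  \<comment> \<open>AM-GM even gives \<open>2 \<bar>x\<bar> \<bar>y\<bar> \<le> x\<^sup>2 + y\<^sup>2\<close>.\<close>
  have "0 \<le> (\<bar>x\<bar> - \<bar>y\<bar>)\<^sup>2" by simp
  then have "\<bar>x\<bar> * \<bar>y\<bar> \<le> x\<^sup>2 + y\<^sup>2"
    using mult_nonneg_nonneg[of "\<bar>x\<bar>" "\<bar>y\<bar>"] unfolding power2_diff power2_abs by linarith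
  then show ?thesis unfolding ind using assms(1,2)
    by (intro divide_left_mono real_sqrt_le_mono) (auto intro!: mult_pos_pos add_pos_pos)
qed

section \<open>Integration over boxes and over the half-plane\<close>

lemma borel_measurable_inv_sqrt_near [measurable]: "inv_sqrt_near R \<in> borel_measurable borel"
  unfolding inv_sqrt_near_def by measurable

lemma nn_integral_inv_sqrt_near_le:
  assumes R: "R \<ge> 0"
  shows "(\<integral>\<^sup>+ x. ennreal (inv_sqrt_near R (x - a)) \<partial>lborel) \<le> ennreal (4 * sqrt R)"
proof -
  let ?h = "\<lambda>x. ennreal (x powr (-1/2)) * indicator {0..R} x"
  have h: "(\<integral>\<^sup>+ x. ?h x \<partial>lborel) = ennreal (2 * sqrt R)"
    using nn_integral_has_integral_lebesgue'[OF _ has_integral_powr_from_0[of "-1/2" R]] R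
    by (simp add: powr_half_sqrt mult.commute)
  have h': "(\<integral>\<^sup>+ x. ?h (- x) \<partial>lborel) = ennreal (2 * sqrt R)"
    using nn_integral_real_affine[of ?h "-1" 0] h by simp
  \<comment> \<open>Translate to \<open>a = 0\<close> and treat the two halves of the interval separately.\<close>
  have "(\<integral>\<^sup>+ x. ennreal (inv_sqrt_near R (x - a)) \<partial>lborel)
      = (\<integral>\<^sup>+ x. ennreal (inv_sqrt_near R x) \<partial>lborel)"
    using nn_integral_real_affine[of "\<lambda>x. ennreal (inv_sqrt_near R (x - a))" 1 a] by simp
  also have "\<dots> \<le> (\<integral>\<^sup>+ x. ?h x + ?h (- x) \<partial>lborel)"
  proof (rule nn_integral_mono)
    fix x :: real
    show "ennreal (inv_sqrt_near R x) \<le> ?h x + ?h (- x)"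
      by (cases "x \<ge> 0") (auto simp: inv_sqrt_near_def indicator_def)
  qed
  also have "\<dots> = ennreal (2 * sqrt R) + ennreal (2 * sqrt R)"
    by (subst nn_integral_add) (simp_all only: h h', measurable)
  also have "\<dots> = ennreal (4 * sqrt R)"
    using R by (subst ennreal_plus[symmetric]) auto
  finally show ?thesis .
qed

lemma nn_integral_lborel_prod_mult:
  fixes f g :: "real \<Rightarrow> ennreal"
  assumes [measurable]: "f \<in> borel_measurable borel" "g \<in> borel_measurable borel"
  shows "(\<integral>\<^sup>+ q. f (fst q) * g (snd q) \<partial>lborel) = (\<integral>\<^sup>+ x. f x \<partial>lborel) * (\<integral>\<^sup>+ y. g y \<partial>lborel)"
proof -
  have "(\<integral>\<^sup>+ q. f (fst q) * g (snd q) \<partial>lborel)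
      = (\<integral>\<^sup>+ q. f (fst q) * g (snd q) \<partial>(lborel \<Otimes>\<^sub>M lborel))"
    by (simp add: lborel_prod)
  also have "\<dots> = (\<integral>\<^sup>+ x. (\<integral>\<^sup>+ y. f x * g y \<partial>lborel) \<partial>lborel)"
    by (subst lborel.nn_integral_fst[symmetric]) simp_all
  also have "\<dots> = (\<integral>\<^sup>+ x. f x * (\<integral>\<^sup>+ y. g y \<partial>lborel) \<partial>lborel)"
    by (simp add: nn_integral_cmult)
  also have "\<dots> = (\<integral>\<^sup>+ x. f x \<partial>lborel) * (\<integral>\<^sup>+ y. g y \<partial>lborel)"
    by (rule nn_integral_multc) simp
  finally show ?thesis .
qed

lemma closed_half_plane: "closed half_plane"
  unfolding half_plane_def split_beta by (intro closed_Collect_le continuous_intros)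

lemma half_plane_sets [measurable]: "half_plane \<in> sets borel"
  using closed_half_plane by (rule borel_closed)

lemma half_plane_sets_lebesgue [simp]: "half_plane \<in> sets lebesgue"
  using half_plane_sets by simp

lemma nn_integral_half_plane_le_lborel:
  "(\<integral>\<^sup>+ q. f q \<partial>half_plane_measure) \<le> (\<integral>\<^sup>+ q. f q \<partial>lborel)"
proof -
  have "(\<integral>\<^sup>+ q. f q \<partial>half_plane_measure) = (\<integral>\<^sup>+ q. f q * indicator half_plane q \<partial>lborel)"
    by (subst nn_integral_restrict_space) (simp_all add: nn_integral_completion)
  also have "\<dots> \<le> (\<integral>\<^sup>+ q. f q \<partial>lborel)"
    by (rule nn_integral_mono) (auto simp: indicator_def)
  finally show ?thesis .
qed

lemma AE_half_plane_off_lines: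
  "AE q in half_plane_measure. fst q \<noteq> a \<and> snd q \<noteq> b"
proof -
  have "{q :: real \<times> real. (1, 0) \<bullet> q = a} \<in> null_sets lebesgue"
       "{q :: real \<times> real. (0, 1) \<bullet> q = b} \<in> null_sets lebesgue"
    by (auto intro!: negligible_hyperplane simp: negligible_iff_null_sets[symmetric] zero_prod_def)
  then have "AE q in lebesgue. \<not> (1, 0) \<bullet> (q :: real \<times> real) = a"
       "AE q in lebesgue. \<not> (0, 1) \<bullet> (q :: real \<times> real) = b"
    by (auto dest: AE_not_in)
  then have "AE q in lebesgue. fst q \<noteq> a \<and> snd q \<noteq> b"
    by eventually_elim (auto simp: inner_prod_def)
  then have "AE q in lebesgue. q \<in> half_plane \<longrightarrow> fst q \<noteq> a \<and> snd q \<noteq> b"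
    by eventually_elim simp
  then show ?thesis by (subst AE_restrict_space_iff) simp_all
qed

section \<open>Splitting the velocity integral\<close>

text \<open>
  The pointwise form of the interpolation: either the kernel is at most \<open>t r\<close>, or the point lies in
  both small boxes, and there the weight \<open>\<bar>w\<bar> \<le> D r\<close> is used instead. Multiplying the kernel bound by
  \<open>r\<close> makes it at most \<open>(1 + rb / d) / 2\<close>, because \<open>r \<le> e\<close> and \<open>r \<le> rb + d\<close>.
\<close>

lemma bs_kernel_split:
  assumes rb: "rb > 0" and t: "t > 0" and D: "D \<ge> 0" and r: "r \<ge> 0"
    and w: "\<bar>w\<bar> \<le> D * r" and off: "r \<noteq> rb" "z \<noteq> zb"
    and \<rho>: "\<rho> = sqrt (1 / (2 * t))"
  shows "\<bar>bs_kernel (rb, zb) (r, z)\<bar> * \<bar>w\<bar> \<le> t * (r * \<bar>w\<bar>)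
    + D / 2 * (indicator {-\<rho>..\<rho>} (r - rb) * indicator {-\<rho>..\<rho>} (z - zb)
        + rb * (inv_sqrt_near (\<rho>\<^sup>2 / rb) (r - rb) * inv_sqrt_near (\<rho>\<^sup>2 / rb) (z - zb)))"
    (is "_ \<le> _ + D / 2 * (?I + rb * ?J)")
proof (cases "\<bar>bs_kernel (rb, zb) (r, z)\<bar> \<le> t * r")
  case True
  have "\<bar>bs_kernel (rb, zb) (r, z)\<bar> * \<bar>w\<bar> \<le> t * r * \<bar>w\<bar>"
    by (rule mult_right_mono[OF True]) simp
  moreover have "0 \<le> D / 2 * (?I + rb * ?J)"
    using D rb by (intro mult_nonneg_nonneg add_nonneg_nonneg inv_sqrt_near_nonneg) auto
  ultimately show ?thesis by simp
next
  case False
  define d where "d = sqrt ((r - rb)\<^sup>2 + (z - zb)\<^sup>2)"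
  define e where "e = sqrt ((r + rb)\<^sup>2 + (z - zb)\<^sup>2)"
  have d0: "d > 0" unfolding d_def using off by (auto intro!: add_nonneg_pos)
  have re: "r + rb \<le> e" unfolding e_def by (rule real_le_rsqrt) auto
  have de: "d \<le> e"
    unfolding d_def e_def using r rb by (simp add: power2_eq_square algebra_simps)
  have rd: "\<bar>r - rb\<bar> \<le> d" "\<bar>z - zb\<bar> \<le> d"
    unfolding d_def by (rule real_sqrt_ge_abs1 real_sqrt_ge_abs2)+
  have e0: "e > 0" using d0 de by linarith
  have K: "\<bar>bs_kernel (rb, zb) (r, z)\<bar> \<le> r / (2 * d * e)"
    using abs_bs_kernel_le[OF rb r] by (simp add: d_def e_def)
  with False have "t * r < r / (2 * d * e)" by linarith
  then have r0: "r > 0" and "t * (2 * d * e) < 1"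
    using r d0 e0 by (cases "r = 0"; simp add: field_simps)+
  then have small: "d * e < \<rho>\<^sup>2" using t by (simp add: \<rho> field_simps)
  have "d\<^sup>2 < \<rho>\<^sup>2"
    using mult_left_mono[OF de, of d] small d0 unfolding power2_eq_square by linarith
  then have "d \<le> \<rho>" by (rule power2_le_imp_le[OF less_imp_le]) (use t in \<open>simp add: \<rho>\<close>)
  then have I: "?I = 1" using rd by (auto simp: indicator_def)
  have "d * rb < \<rho>\<^sup>2"
    using mult_left_mono[of rb e d] small d0 re r by linarith
  then have "d \<le> \<rho>\<^sup>2 / rb" using rb by (simp add: field_simps)
  then have J: "1 / d \<le> ?J"
    unfolding d_def using off by (intro inverse_norm_le_inv_sqrt_near) auto
  have "\<bar>bs_kernel (rb, zb) (r, z)\<bar> * \<bar>w\<bar> \<le> r / (2 * d * e) * (D * r)"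
    by (rule mult_mono[OF K w]) (use r d0 e0 in auto)
  also have "\<dots> = D / 2 * (r / d * (r / e))" by (simp add: mult_ac)
  also have "\<dots> \<le> D / 2 * (r / d * 1)"
    using r0 d0 e0 re rb D by (intro mult_left_mono) auto
  also have "\<dots> \<le> D / 2 * (1 + rb * (1 / d))"
    using rd d0 D by (intro mult_left_mono) (auto simp: field_simps)
  also have "\<dots> \<le> D / 2 * (?I + rb * ?J)"
    unfolding I using J D rb by (intro mult_left_mono add_left_mono) auto
  finally show ?thesis using t r by (simp add: add_increasing)
qed

lemma borel_measurable_half_plane:
  "f \<in> borel_measurable borel \<Longrightarrow> f \<in> borel_measurable half_plane_measure"
  by (intro measurable_restrict_space1 measurable_completion) simp

lemma borel_measurable_coordinates [measurable]:
  "fst \<in> borel_measurable (borel :: (real \<times> real) measure)"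
  "snd \<in> borel_measurable (borel :: (real \<times> real) measure)"
  by (auto intro!: borel_measurable_continuous_onI continuous_intros)

lemma borel_measurable_half_plane_coordinates [measurable]:
  "fst \<in> borel_measurable half_plane_measure"
  "snd \<in> borel_measurable half_plane_measure"
  by (auto intro: borel_measurable_half_plane)

text \<open>
  Integrating \<open>bs_kernel_split\<close>. The boxes contribute \<open>(D / 2) (4 \<rho>\<^sup>2 + 16 rb R)\<close> with
  \<open>R = \<rho>\<^sup>2 / rb\<close>, that is \<open>10 D \<rho>\<^sup>2 = 5 D / t\<close>, for every \<open>rb > 0\<close>.
\<close>

lemma nn_integral_bs_kernel_le:
  assumes [measurable]: "\<omega> \<in> borel_measurable half_plane_measure"
    and D: "D \<ge> 0" and bounded: "AE q in half_plane_measure. \<bar>\<omega> q\<bar> \<le> D * fst q"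
    and M: "M \<ge> 0" and mass: "(\<integral>\<^sup>+ q. ennreal (fst q * \<bar>\<omega> q\<bar>) \<partial>half_plane_measure) \<le> ennreal M"
    and t: "t > 0" and rb: "rb > 0"
  shows "(\<integral>\<^sup>+ q. ennreal \<bar>bs_kernel (rb, zb) q * \<omega> q\<bar> \<partial>half_plane_measure) \<le> ennreal (t * M + 5 * D / t)"
proof -
  define \<rho> where "\<rho> = sqrt (1 / (2 * t))"
  define R where "R = \<rho>\<^sup>2 / rb"
  have \<rho>: "\<rho> > 0" "\<rho>\<^sup>2 = 1 / (2 * t)" and R: "R > 0" "rb * R = \<rho>\<^sup>2"
    using t rb by (auto simp: \<rho>_def R_def)
  let ?I = "\<lambda>a x. indicator {-\<rho>..\<rho>} (x - a) :: real"
  let ?J = "\<lambda>a x. inv_sqrt_near R (x - a)"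
  let ?B = "\<lambda>q. ennreal (D / 2) * (ennreal (?I rb (fst q)) * ennreal (?I zb (snd q))
        + ennreal rb * (ennreal (?J rb (fst q)) * ennreal (?J zb (snd q))))"
  have box: "(\<integral>\<^sup>+ x. ennreal (?I a x) \<partial>lborel) = ennreal (2 * \<rho>)" for a
  proof -
    have "(\<integral>\<^sup>+ x. ennreal (?I a x) \<partial>lborel) = (\<integral>\<^sup>+ x. indicator {a-\<rho>..a+\<rho>} x \<partial>lborel)"
      by (rule nn_integral_cong) (auto simp: indicator_def)
    then show ?thesis using \<rho> by simp
  qed
  have "AE q in half_plane_measure. q \<in> half_plane"
    by (rule AE_I2) simp
  then have "AE q in half_plane_measure. ennreal \<bar>bs_kernel (rb, zb) q * \<omega> q\<bar>
      \<le> ennreal t * ennreal (fst q * \<bar>\<omega> q\<bar>) + ?B q"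
    using bounded AE_half_plane_off_lines[of rb zb]
  proof eventually_elim
    fix q assume "q \<in> half_plane" and w: "\<bar>\<omega> q\<bar> \<le> D * fst q" and off: "fst q \<noteq> rb \<and> snd q \<noteq> zb"
    then have r: "0 \<le> fst q" by (auto simp: half_plane_def)
    have "ennreal \<bar>bs_kernel (rb, zb) q * \<omega> q\<bar> \<le> ennreal (t * (fst q * \<bar>\<omega> q\<bar>)
        + D / 2 * (?I rb (fst q) * ?I zb (snd q) + rb * (?J rb (fst q) * ?J zb (snd q))))"
      using bs_kernel_split[OF rb t D r w _ _ \<rho>_def, of "snd q" zb] off
      by (intro ennreal_leI) (simp add: abs_mult R_def)
    also have "\<dots> = ennreal t * ennreal (fst q * \<bar>\<omega> q\<bar>) + ennreal (D / 2) *
        ennreal (?I rb (fst q) * ?I zb (snd q) + rb * (?J rb (fst q) * ?J zb (snd q)))"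
      using t r D rb by (intro ennreal_linear_combination) (simp_all add: inv_sqrt_near_nonneg)
    also have "\<dots> = ennreal t * ennreal (fst q * \<bar>\<omega> q\<bar>) + ?B q"
      using rb by (simp add: ennreal_plus ennreal_mult inv_sqrt_near_nonneg)
    finally show "ennreal \<bar>bs_kernel (rb, zb) q * \<omega> q\<bar> \<le> ennreal t * ennreal (fst q * \<bar>\<omega> q\<bar>) + ?B q" .
  qed
  then have "(\<integral>\<^sup>+ q. ennreal \<bar>bs_kernel (rb, zb) q * \<omega> q\<bar> \<partial>half_plane_measure)
      \<le> (\<integral>\<^sup>+ q. ennreal t * ennreal (fst q * \<bar>\<omega> q\<bar>) + ?B q \<partial>half_plane_measure)"
    by (rule nn_integral_mono_AE)
  also have "\<dots> = ennreal t * (\<integral>\<^sup>+ q. ennreal (fst q * \<bar>\<omega> q\<bar>) \<partial>half_plane_measure)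
      + (\<integral>\<^sup>+ q. ?B q \<partial>half_plane_measure)"
    by (subst nn_integral_add) (simp_all add: nn_integral_cmult)
  also have "\<dots> \<le> ennreal t * ennreal M + (\<integral>\<^sup>+ q. ?B q \<partial>lborel)"
    by (intro add_mono mult_left_mono mass nn_integral_half_plane_le_lborel) simp
  also have "(\<integral>\<^sup>+ q. ?B q \<partial>lborel) = ennreal (D / 2) *
      ((\<integral>\<^sup>+ q. ennreal (?I rb (fst q)) * ennreal (?I zb (snd q)) \<partial>lborel)
        + ennreal rb * (\<integral>\<^sup>+ q. ennreal (?J rb (fst q)) * ennreal (?J zb (snd q)) \<partial>lborel))"
    by (simp add: nn_integral_cmult nn_integral_add)
  also have "(\<integral>\<^sup>+ q. ennreal (?I rb (fst q)) * ennreal (?I zb (snd q)) \<partial>lborel)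
      = ennreal (2 * \<rho>) * ennreal (2 * \<rho>)"
    by (subst nn_integral_lborel_prod_mult) (simp_all only: box, measurable)
  also have "(\<integral>\<^sup>+ q. ennreal (?J rb (fst q)) * ennreal (?J zb (snd q)) \<partial>lborel)
      = (\<integral>\<^sup>+ x. ennreal (?J rb x) \<partial>lborel) * (\<integral>\<^sup>+ x. ennreal (?J zb x) \<partial>lborel)"
    by (rule nn_integral_lborel_prod_mult) measurable
  also have "ennreal t * ennreal M + ennreal (D / 2) * (ennreal (2 * \<rho>) * ennreal (2 * \<rho>)
        + ennreal rb * ((\<integral>\<^sup>+ x. ennreal (?J rb x) \<partial>lborel) * (\<integral>\<^sup>+ x. ennreal (?J zb x) \<partial>lborel)))
      \<le> ennreal t * ennreal M + ennreal (D / 2) * (ennreal (2 * \<rho>) * ennreal (2 * \<rho>)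
        + ennreal rb * (ennreal (4 * sqrt R) * ennreal (4 * sqrt R)))"
    using R by (intro add_left_mono mult_left_mono mult_mono nn_integral_inv_sqrt_near_le) auto
  also have "\<dots> = ennreal (t * M + D / 2 * (2 * \<rho> * (2 * \<rho>) + rb * (4 * sqrt R * (4 * sqrt R))))"
  proof -
    have "ennreal a * ennreal m + ennreal b * (ennreal p * ennreal p + ennreal c * (ennreal s * ennreal s))
        = ennreal (a * m + b * (p * p + c * (s * s)))"
      if "0 \<le> a" "0 \<le> m" "0 \<le> b" "0 \<le> p" "0 \<le> c" "0 \<le> s" for a m b p c s :: real
      using that by (simp add: ennreal_plus ennreal_mult)
    then show ?thesis using t M D \<rho>(1) R(1) rb by simp
  qed
  also have "2 * \<rho> * (2 * \<rho>) + rb * (4 * sqrt R * (4 * sqrt R)) = 4 * \<rho>\<^sup>2 + 16 * (rb * R)"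
    using R(1) by (simp add: power2_eq_square)
  also have "t * M + D / 2 * (4 * \<rho>\<^sup>2 + 16 * (rb * R)) = t * M + 5 * D / t"
    unfolding R(2) \<rho>(2) using t by (simp add: field_simps)
  finally show ?thesis .
qed

section \<open>Measurability of the velocity\<close>

text \<open>
  The function \<open>deriv F\<close> is continuous on \<open>s > 0\<close>, and its argument is nonnegative when both points lie
  in the half-plane. So it may be replaced by its restriction to \<open>s > 0\<close>, extended by the constant
  \<open>deriv F 0\<close>, which is a Borel function.
\<close>

lemma borel_version_of_bs_kernel:
  obtains K where "(\<lambda>(p, q). K p q) \<in> borel_measurable (borel \<Otimes>\<^sub>M borel)"
    "\<forall>p\<in>half_plane. \<forall>q\<in>half_plane. bs_kernel p q = K p q"
proof -
  define F' where "F' s = (if s \<in> {0<..} then deriv F s else deriv F 0)" for s :: real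
  have [measurable]: "F' \<in> borel_measurable borel"
    unfolding F'_def
    by (rule borel_measurable_continuous_on_if) (auto intro: continuous_on_deriv_F)
  have F': "F' s = deriv F s" if "s \<ge> 0" for s
    using that by (cases "s = 0") (auto simp: F'_def)
  define K where "K p q = (snd q - snd p) / (pi * fst p powr (3/2) * sqrt (fst q))
     * F' (((fst q - fst p)\<^sup>2 + (snd q - snd p)\<^sup>2) / (fst p * fst q))" for p q :: "real \<times> real"
  show thesis
  proof (rule that)
    show "(\<lambda>(p, q). K p q) \<in> borel_measurable (borel \<Otimes>\<^sub>M borel)"
      unfolding K_def split_beta borel_prod[symmetric] by measurable
  next
    show "\<forall>p\<in>half_plane. \<forall>q\<in>half_plane. bs_kernel p q = K p q"
    proof (intro ballI)
      fix p q assume "p \<in> half_plane" "q \<in> half_plane"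
      then have "0 \<le> ((fst q - fst p)\<^sup>2 + (snd q - snd p)\<^sup>2) / (fst p * fst q)"
        by (intro divide_nonneg_nonneg add_nonneg_nonneg mult_nonneg_nonneg) (auto simp: half_plane_def)
      then show "bs_kernel p q = K p q"
        by (simp add: bs_kernel_def K_def F')
    qed
  qed
qed

lemma borel_measurable_biot_savart_integrand:
  assumes [measurable]: "\<omega> \<in> borel_measurable half_plane_measure" and "rb \<ge> 0"
  shows "biot_savart_integrand \<omega> (rb, zb) \<in> borel_measurable half_plane_measure"
proof -
  obtain K where K: "(\<lambda>(p, q). K p q) \<in> borel_measurable (borel \<Otimes>\<^sub>M borel)"
    and eq: "\<forall>p\<in>half_plane. \<forall>q\<in>half_plane. bs_kernel p q = K p q"
    by (rule borel_version_of_bs_kernel)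
  have [measurable]: "K (rb, zb) \<in> borel_measurable half_plane_measure"
    using measurable_Pair2[OF K, of "(rb, zb)"] by (intro borel_measurable_half_plane) simp
  have "(\<lambda>q. K (rb, zb) q * \<omega> q) \<in> borel_measurable half_plane_measure"
    by measurable
  then show ?thesis
    using assms(2)
    by (subst measurable_cong) (auto simp: biot_savart_integrand_eq eq half_plane_def)
qed

lemma borel_version_on_half_plane:
  assumes "\<omega> \<in> borel_measurable half_plane_measure"
  obtains \<omega>' :: "real \<times> real \<Rightarrow> real" where "\<omega>' \<in> borel_measurable borel"
    "AE q in half_plane_measure. \<omega> q = \<omega>' q"
proof -
  have "(\<lambda>q. if q \<in> half_plane then \<omega> q else 0) \<in> borel_measurable lebesgue"
    using assms by (simp add: borel_measurable_if)
  then obtain \<omega>' where \<omega>': "\<omega>' \<in> borel_measurable lborel"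
    and ae: "AE q in lborel. (if q \<in> half_plane then \<omega> q else 0) = \<omega>' q"
    using completion_ex_borel_measurable_real by blast
  from ae have "AE q in lebesgue. (if q \<in> half_plane then \<omega> q else 0) = \<omega>' q"
    by (rule AE_completion)
  then have "AE q in lebesgue. q \<in> half_plane \<longrightarrow> \<omega> q = \<omega>' q"
    by eventually_elim auto
  then have "AE q in half_plane_measure. \<omega> q = \<omega>' q"
    by (subst AE_restrict_space_iff) simp_all
  with \<omega>' show thesis by (intro that) simp
qed

text \<open>
  Measurability of a parameter integral comes from Fubini's theorem, which needs joint measurability
  with respect to the product of the Borel algebras. The vorticity is only Lebesgue measurable, but
  changing it on a null set does not affect the velocity.
\<close>

lemma borel_measurable_radial_velocity:
  assumes \<omega>[measurable]: "\<omega> \<in> borel_measurable half_plane_measure"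
  shows "radial_velocity \<omega> \<in> borel_measurable half_plane_measure"
proof -
  obtain K where K[measurable]: "(\<lambda>(p, q). K p q) \<in> borel_measurable (borel \<Otimes>\<^sub>M borel)"
    and eq: "\<forall>p\<in>half_plane. \<forall>q\<in>half_plane. bs_kernel p q = K p q"
    by (rule borel_version_of_bs_kernel)
  obtain \<omega>' where \<omega>'[measurable]: "\<omega>' \<in> borel_measurable borel"
    and ae: "AE q in half_plane_measure. \<omega> q = \<omega>' q"
    by (rule borel_version_on_half_plane[OF \<omega>])
  note [measurable] = \<omega>'[THEN borel_measurable_half_plane]
  define v where "v p = (\<integral>q. indicator half_plane q *\<^sub>R (K p q * \<omega>' q) \<partial>lborel)" for p
  have "v \<in> borel_measurable borel"
    unfolding v_def by (rule lborel.borel_measurable_lebesgue_integral) measurable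
  moreover have "radial_velocity \<omega> p = v p" if p: "p \<in> half_plane" for p
  proof -
    have K_p [measurable]: "K p \<in> borel_measurable borel"
      using measurable_Pair2[OF K, of p] by simp
    note [measurable] = K_p[THEN borel_measurable_half_plane]
    have "radial_velocity \<omega> p = (\<integral>q. K p q * \<omega> q \<partial>half_plane_measure)"
      unfolding radial_velocity_def
      by (rule Bochner_Integration.integral_cong) (auto simp: biot_savart_integrand_eq eq p)
    also have "\<dots> = (\<integral>q. K p q * \<omega>' q \<partial>half_plane_measure)"
      by (rule integral_cong_AE) (use ae in \<open>auto\<close>)
    also have "\<dots> = v p"
      unfolding v_def by (subst integral_restrict_space) (simp_all add: integral_completion)
    finally show ?thesis .
  qed
  ultimately show ?thesis
    by (subst measurable_cong[where g = v]) (auto intro: borel_measurable_half_plane)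
qed

section \<open>The bound for the radial velocity\<close>

text \<open>
  The Cauchy-Schwarz inequality for \<open>r \<bar>\<omega>\<bar> = (r sqrt \<bar>\<omega>\<bar>) (sqrt \<bar>\<omega>\<bar>)\<close>, obtained by integrating
  \<open>r \<le> t r\<^sup>2 / 2 + 1 / (2 t)\<close> and optimising over \<open>t\<close>.
\<close>

lemma radial_moment_le:
  assumes [measurable]: "\<omega> \<in> borel_measurable half_plane_measure"
    and A: "(\<integral>\<^sup>+ q. ennreal ((fst q)\<^sup>2 * \<bar>\<omega> q\<bar>) \<partial>half_plane_measure) = ennreal A" "A \<ge> 0"
    and B: "(\<integral>\<^sup>+ q. ennreal \<bar>\<omega> q\<bar> \<partial>half_plane_measure) = ennreal B" "B \<ge> 0"
  shows "(\<integral>\<^sup>+ q. ennreal (fst q * \<bar>\<omega> q\<bar>) \<partial>half_plane_measure) \<le> ennreal (sqrt (A * B))"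
proof -
  let ?I = "\<integral>\<^sup>+ q. ennreal (fst q * \<bar>\<omega> q\<bar>) \<partial>half_plane_measure"
  have I: "?I \<le> ennreal (t * (A / 2) + (B / 2) / t)" if t: "t > 0" for t
  proof -
    have "?I \<le> (\<integral>\<^sup>+ q. ennreal (t / 2) * ennreal ((fst q)\<^sup>2 * \<bar>\<omega> q\<bar>)
        + ennreal (1 / (2 * t)) * ennreal \<bar>\<omega> q\<bar> \<partial>half_plane_measure)"
    proof (rule nn_integral_mono)
      fix q :: "real \<times> real"
      have "0 \<le> (t * fst q - 1)\<^sup>2 / (2 * t)" using t by simp
      then have "fst q \<le> t / 2 * (fst q)\<^sup>2 + 1 / (2 * t)"
        using t by (simp add: field_simps power2_eq_square)
      from mult_right_mono[OF this, of "\<bar>\<omega> q\<bar>"]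
      have "ennreal (fst q * \<bar>\<omega> q\<bar>) \<le> ennreal (t / 2 * ((fst q)\<^sup>2 * \<bar>\<omega> q\<bar>) + 1 / (2 * t) * \<bar>\<omega> q\<bar>)"
        by (intro ennreal_leI) (simp add: algebra_simps)
      also have "\<dots> = ennreal (t / 2) * ennreal ((fst q)\<^sup>2 * \<bar>\<omega> q\<bar>) + ennreal (1 / (2 * t)) * ennreal \<bar>\<omega> q\<bar>"
        using t by (intro ennreal_linear_combination) auto
      finally show "ennreal (fst q * \<bar>\<omega> q\<bar>) \<le> ennreal (t / 2) * ennreal ((fst q)\<^sup>2 * \<bar>\<omega> q\<bar>)
        + ennreal (1 / (2 * t)) * ennreal \<bar>\<omega> q\<bar>" .
    qed
    also have "\<dots> = ennreal (t / 2) * ennreal A + ennreal (1 / (2 * t)) * ennreal B"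
      by (subst nn_integral_add) (simp_all add: nn_integral_cmult A B)
    also have "\<dots> = ennreal (t / 2 * A + 1 / (2 * t) * B)"
      using t A B by (intro ennreal_linear_combination[symmetric]) auto
    finally show ?thesis by simp
  qed
  have fin: "?I < top" using I[of 1] by (simp add: le_less_trans)
  have "enn2real ?I \<le> 2 * sqrt (A / 2 * (B / 2))"
  proof (rule le_two_sqrt_mult)
    fix t :: real assume t: "t > 0"
    have "0 \<le> t * (A / 2) + (B / 2) / t" using t A B by simp
    then show "enn2real ?I \<le> t * (A / 2) + (B / 2) / t"
      using enn2real_mono[OF I[OF t]] by simp
  qed (use A B in auto)
  also have "\<dots> = sqrt (A * B)" by (simp add: real_sqrt_divide real_sqrt_mult)
  finally have "ennreal (enn2real ?I) \<le> ennreal (sqrt (A * B))"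
    by (rule ennreal_leI)
  then show ?thesis using fin by simp
qed

text \<open>
  Any single \<open>t\<close> shows that the integral converges absolutely; the value of the velocity does not depend
  on \<open>t\<close>, so it obeys the bound for the best one.
\<close>

lemma abs_radial_velocity_le:
  assumes [measurable]: "\<omega> \<in> borel_measurable half_plane_measure"
    and D: "D \<ge> 0" and bounded: "AE q in half_plane_measure. \<bar>\<omega> q\<bar> \<le> D * fst q"
    and M: "M \<ge> 0" and mass: "(\<integral>\<^sup>+ q. ennreal (fst q * \<bar>\<omega> q\<bar>) \<partial>half_plane_measure) \<le> ennreal M"
    and rb: "rb > 0"
  shows integrable_biot_savart_integrand:
      "integrable half_plane_measure (biot_savart_integrand \<omega> (rb, zb))"
    and "\<bar>radial_velocity \<omega> (rb, zb)\<bar> \<le> 2 * sqrt (5 * M * D)"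
proof -
  let ?f = "biot_savart_integrand \<omega> (rb, zb)"
  have bound: "(\<integral>\<^sup>+ q. ennreal (norm (?f q)) \<partial>half_plane_measure) \<le> ennreal (t * M + 5 * D / t)"
    if "t > 0" for t
    using nn_integral_bs_kernel_le[OF assms(1) D bounded M mass that rb, of zb]
    by (simp add: biot_savart_integrand_eq)
  show int: "integrable half_plane_measure ?f"
    using bound[of 1] rb
    by (intro integrableI_bounded borel_measurable_biot_savart_integrand) (auto simp: le_less_trans)
  have "\<bar>radial_velocity \<omega> (rb, zb)\<bar> \<le> 2 * sqrt (M * (5 * D))"
  proof (rule le_two_sqrt_mult)
    fix t :: real assume t: "t > 0"
    have nonneg: "0 \<le> t * M + 5 * D / t" using t M D by simp
    have "ennreal (norm (radial_velocity \<omega> (rb, zb))) \<le> (\<integral>\<^sup>+ q. ennreal (norm (?f q)) \<partial>half_plane_measure)"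
      unfolding radial_velocity_def by (rule integral_norm_bound_ennreal[OF int])
    also note bound[OF t]
    finally show "\<bar>radial_velocity \<omega> (rb, zb)\<bar> \<le> t * M + 5 * D / t"
      using nonneg by simp
  qed (use M D in auto)
  then show "\<bar>radial_velocity \<omega> (rb, zb)\<bar> \<le> 2 * sqrt (5 * M * D)"
    by (simp add: mult_ac)
qed

theorem proposition2p11:
  shows "\<exists>C\<^sub>1 :: real. \<forall>\<omega> :: real \<times> real \<Rightarrow> real.
    \<omega> \<in> borel_measurable half_plane_measure \<longrightarrow>
    L1_norm half_plane_measure (\<lambda>(r, z). r\<^sup>2 * \<omega> (r, z)) < \<infinity> \<longrightarrow>
    L1_norm half_plane_measure \<omega> < \<infinity> \<longrightarrow>
    Linf_norm half_plane_measure (\<lambda>(r, z). \<omega> (r, z) / r) < \<infinity> \<longrightarrow>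
    (\<forall>rb zb. rb > 0 \<longrightarrow> integrable half_plane_measure (biot_savart_integrand \<omega> (rb, zb))) \<and>
    Linf_norm half_plane_measure (radial_velocity \<omega>)
      \<le> ennreal (C\<^sub>1
          * enn2real (L1_norm half_plane_measure (\<lambda>(r, z). r\<^sup>2 * \<omega> (r, z))) powr (1/4)
          * enn2real (L1_norm half_plane_measure \<omega>) powr (1/4)
          * enn2real (Linf_norm half_plane_measure (\<lambda>(r, z). \<omega> (r, z) / r)) powr (1/2))"
proof (rule exI[of _ "2 * sqrt 5"], intro allI impI)
  fix \<omega> :: "real \<times> real \<Rightarrow> real"
  assume \<omega>[measurable]: "\<omega> \<in> borel_measurable half_plane_measure"
    and A_fin: "L1_norm half_plane_measure (\<lambda>(r, z). r\<^sup>2 * \<omega> (r, z)) < \<infinity>"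
    and B_fin: "L1_norm half_plane_measure \<omega> < \<infinity>"
    and D_fin: "Linf_norm half_plane_measure (\<lambda>(r, z). \<omega> (r, z) / r) < \<infinity>"
  define A where "A = enn2real (L1_norm half_plane_measure (\<lambda>(r, z). r\<^sup>2 * \<omega> (r, z)))"
  define B where "B = enn2real (L1_norm half_plane_measure \<omega>)"
  define D where "D = enn2real (Linf_norm half_plane_measure (\<lambda>(r, z). \<omega> (r, z) / r))"
  have nonneg: "A \<ge> 0" "B \<ge> 0" "D \<ge> 0" by (auto simp: A_def B_def D_def)
  have A: "(\<integral>\<^sup>+ q. ennreal ((fst q)\<^sup>2 * \<bar>\<omega> q\<bar>) \<partial>half_plane_measure) = ennreal A"
    using A_fin by (simp add: A_def L1_norm_def split_beta abs_mult less_top)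
  have B: "(\<integral>\<^sup>+ q. ennreal \<bar>\<omega> q\<bar> \<partial>half_plane_measure) = ennreal B"
    using B_fin by (simp add: B_def L1_norm_def less_top)
  define M where "M = sqrt (A * B)"
  have M: "M \<ge> 0" using nonneg by (simp add: M_def)
  have mass: "(\<integral>\<^sup>+ q. ennreal (fst q * \<bar>\<omega> q\<bar>) \<partial>half_plane_measure) \<le> ennreal M"
    unfolding M_def by (rule radial_moment_le[OF \<omega> A nonneg(1) B nonneg(2)])
  have "AE q in half_plane_measure. ennreal \<bar>\<omega> q / fst q\<bar> \<le> ennreal D"
    using esssup_AE[of "\<lambda>q. ennreal \<bar>\<omega> q / fst q\<bar>" half_plane_measure] D_fin
    by (simp add: D_def Linf_norm_def split_beta less_top)
  moreover have "AE q in half_plane_measure. q \<in> half_plane"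
    by (rule AE_I2) simp
  ultimately have bounded: "AE q in half_plane_measure. \<bar>\<omega> q\<bar> \<le> D * fst q"
    using AE_half_plane_off_lines[of 0 0]
  proof eventually_elim
    fix q assume "ennreal \<bar>\<omega> q / fst q\<bar> \<le> ennreal D" "q \<in> half_plane" "fst q \<noteq> 0 \<and> snd q \<noteq> 0"
    then have "\<bar>\<omega> q\<bar> / fst q \<le> D" "fst q > 0"
      using nonneg by (auto simp: half_plane_def)
    then show "\<bar>\<omega> q\<bar> \<le> D * fst q" by (simp add: field_simps)
  qed
  let ?C = "2 * sqrt 5 * A powr (1/4) * B powr (1/4) * D powr (1/2)"
  \<comment> \<open>The exponents: \<open>M\<close> is a square root, and enters under a square root again.\<close>
  have C: "2 * sqrt (5 * M * D) = ?C"
    using nonneg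
    by (simp add: M_def real_sqrt_mult powr_half_sqrt[symmetric] powr_powr powr_mult)
  have u: "\<bar>radial_velocity \<omega> p\<bar> \<le> ?C" if p: "p \<in> half_plane" for p
  proof (cases "fst p = 0")
    case True
    \<comment> \<open>On the axis the integrand contains a division by \<open>0 powr (3/2) = 0\<close>.\<close>
    then have "radial_velocity \<omega> p = 0"
      by (simp add: radial_velocity_def biot_savart_integrand_eq bs_kernel_def)
    then show ?thesis using nonneg by simp
  next
    case False
    then have "fst p > 0" using p by (auto simp: half_plane_def)
    from abs_radial_velocity_le[OF \<omega> nonneg(3) bounded M mass this, of "snd p"]
    show ?thesis by (simp only: C prod.collapse)
  qed
  have [measurable]: "radial_velocity \<omega> \<in> borel_measurable half_plane_measure"
    by (rule borel_measurable_radial_velocity[OF \<omega>])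
  have "Linf_norm half_plane_measure (radial_velocity \<omega>) \<le> ennreal ?C"
    unfolding Linf_norm_def
  proof (rule esssup_I)
    show "AE p in half_plane_measure. ennreal \<bar>radial_velocity \<omega> p\<bar> \<le> ennreal ?C"
      by (rule AE_I2) (use u in \<open>simp add: ennreal_leI\<close>)
  qed measurable
  then show "(\<forall>rb zb. rb > 0 \<longrightarrow> integrable half_plane_measure (biot_savart_integrand \<omega> (rb, zb))) \<and>
    Linf_norm half_plane_measure (radial_velocity \<omega>)
      \<le> ennreal (2 * sqrt 5
          * enn2real (L1_norm half_plane_measure (\<lambda>(r, z). r\<^sup>2 * \<omega> (r, z))) powr (1/4)
          * enn2real (L1_norm half_plane_measure \<omega>) powr (1/4)
          * enn2real (Linf_norm half_plane_measure (\<lambda>(r, z). \<omega> (r, z) / r)) powr (1/2))"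
    using integrable_biot_savart_integrand[OF \<omega> nonneg(3) bounded M mass]
    by (simp only: A_def B_def D_def) blast
qed

end
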